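(* Let $\mathcal I$ be an ideal on $\omega$ and let $Y$ be a closed subspace of a Banach space $X$ with $X/Y$ separable. Every bounded operator $T\colon Y\to c_{0,\mathcal I}$ admits an extension $\widetilde T\colon X\to c_{0,\mathcal I}$ (a bounded linear operator with $\widetilde T|_Y=T$) such that $\|\widetilde T\|\le 2\|T\|$. In particular, $c_{0,\mathcal I}$ is $2$-separably injective.
   Context: An ideal on $\omega$ is a collection of subsets of $\omega$ containing $\emptyset$, closed under subsets and finite unions; every ideal is assumed to contain all finite sets. $c_{0,\mathcal I}$ is the closed subspace of $\ell_\infty$ (sup norm) of all bounded scalar sequences $(x_n)$ with $\{n:|x_n|\ge\varepsilon\}\in\mathcal I$ for every $\varepsilon>0$. A Banach space $E$ is $\lambda$-separably injective if for every separable Banach space $X$ and every subspace $Y$ of $X$, each bounded operator $T\colon Y\to E$ admits a bounded extension $\widetilde T\colon X\to E$ with $\|\widetilde T\|\le\lambda\|T\|$. *)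

theory Defs
  imports "HOL-Analysis.Analysis"
begin

text \<open>The scalar field is either the reals or the complex numbers: a field with an isometric
  embedding into the complex numbers whose range is one of these two fields.\<close>

class real_or_complex = real_normed_field + banach +
  assumes real_or_complex_embedding:
    "\<exists>h :: 'a \<Rightarrow> complex.
       (\<forall>x y. h (x + y) = h x + h y) \<and> (\<forall>x y. h (x * y) = h x * h y) \<and>
       (\<forall>r. h (scaleR r 1) = complex_of_real r) \<and> (\<forall>x. norm (h x) = norm x) \<and>
       (range h = \<real> \<or> range h = UNIV)"

instance real :: real_or_complex
  by standard (rule exI[of _ complex_of_real], simp add: Reals_def)

instance complex :: real_or_complex
  by standard (rule exI[of _ id], simp add: scaleR_conv_of_real)

text \<open>HOL-Analysis has Banach spaces over the reals only. A Banach space over the scalar field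
  is a real Banach space with a compatible scalar multiplication for which the norm is
  absolutely homogeneous. For real scalars, the multiplication is necessarily \<^const>\<open>scaleR\<close>.\<close>

locale banach_space = vector_space scale
  for scale :: "'k::real_or_complex \<Rightarrow> 'a::banach \<Rightarrow> 'a" +
  assumes scale_of_real: "scale (of_real r) x = r *\<^sub>R x"
    and norm_scale: "norm (scale c x) = norm c * norm x"

text \<open>Only the values of \<open>T\<close> on the subspace \<open>Y\<close> matter.\<close>

definition bounded_operator_on ::
    "('k \<Rightarrow> 'a::real_normed_vector \<Rightarrow> 'a) \<Rightarrow> ('k \<Rightarrow> 'b::real_normed_vector \<Rightarrow> 'b)
      \<Rightarrow> 'a set \<Rightarrow> 'b set \<Rightarrow> ('a \<Rightarrow> 'b) \<Rightarrow> bool" where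
  "bounded_operator_on s t Y E T \<longleftrightarrow>
     T ` Y \<subseteq> E \<and>
     (\<forall>x\<in>Y. \<forall>y\<in>Y. T (x + y) = T x + T y) \<and>
     (\<forall>c. \<forall>x\<in>Y. T (s c x) = t c (T x)) \<and>
     (\<exists>K. \<forall>x\<in>Y. norm (T x) \<le> K * norm x)"

text \<open>The relative version of \<^const>\<open>onorm\<close>; division by zero makes the quotient at \<open>0\<close> vanish.\<close>

definition onorm_on ::
    "'a::real_normed_vector set \<Rightarrow> ('a \<Rightarrow> 'b::real_normed_vector) \<Rightarrow> real" where
  "onorm_on Y T = (SUP x\<in>Y. norm (T x) / norm x)"

lemma onorm_on_UNIV: "onorm_on UNIV T = onorm T"
  by (simp add: onorm_on_def onorm_def)

definition cosets :: "'a::ab_group_add set \<Rightarrow> 'a set set" where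
  "cosets Y = UNIV // {(x, x'). x - x' \<in> Y}"

text \<open>The infimum of the norms of the elements of \<open>C\<close>. Unlike \<^const>\<open>Inf\<close> on the reals,
  \<^const>\<open>infdist\<close> has a known value (\<open>0\<close>) at the empty set.\<close>

definition quotient_norm :: "'a::real_normed_vector set \<Rightarrow> real" where
  "quotient_norm C = infdist 0 C"

lemma quotient_norm_eq_Inf: "C \<noteq> {} \<Longrightarrow> quotient_norm C = Inf (norm ` C)"
  by (simp add: quotient_norm_def infdist_notempty)

text \<open>The elementwise difference of two cosets is their difference in the quotient space.\<close>

definition quotient_dist :: "'a::real_normed_vector set \<Rightarrow> 'a set \<Rightarrow> real" where
  "quotient_dist C D = quotient_norm {c - d |c d. c \<in> C \<and> d \<in> D}"

definition quotient_topology :: "'a::real_normed_vector set \<Rightarrow> 'a set topology" where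
  "quotient_topology Y = Metric_space.mtopology (cosets Y) quotient_dist"

lemma cosets_alt:
  assumes "subspace Y"
  shows "cosets Y = range (\<lambda>x. (+) x ` Y)"
proof -
  have "{(x, x'). x - x' \<in> Y} `` {x} = (+) x ` Y" for x
  proof (intro set_eqI iffI)
    fix z assume "z \<in> {(x, x'). x - x' \<in> Y} `` {x}"
    then have "- (x - z) \<in> Y" using assms subspace_neg by blast
    then show "z \<in> (+) x ` Y" by (intro image_eqI[of _ _ "z - x"]) auto
  next
    fix z assume "z \<in> (+) x ` Y"
    then show "z \<in> {(x, x'). x - x' \<in> Y} `` {x}" using assms subspace_neg by auto
  qed
  then show ?thesis by (auto simp: cosets_def quotient_def)
qed

lemma quotient_dist_cosets:
  assumes "subspace Y"
  shows "quotient_dist ((+) x ` Y) ((+) y ` Y) = infdist (x - y) Y"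
proof -
  have "{c - d |c d. c \<in> (+) x ` Y \<and> d \<in> (+) y ` Y} = (\<lambda>z. (x - y) - z) ` Y" (is "?A = ?B")
  proof (intro set_eqI iffI)
    fix w assume "w \<in> ?A"
    then obtain a b where ab: "a \<in> Y" "b \<in> Y" "w = (x + a) - (y + b)" by blast
    then have "b - a \<in> Y" using assms subspace_diff by blast
    with ab show "w \<in> ?B" by (intro image_eqI[of _ _ "b - a"]) auto
  next
    fix w assume "w \<in> ?B"
    then obtain z where z: "z \<in> Y" "w = (x + 0) - (y + z)" by auto
    with subspace_0[OF assms] show "w \<in> ?A" by blast
  qed
  moreover have "Y \<noteq> {}" using subspace_0[OF assms] by blast
  ultimately show ?thesis
    by (simp add: quotient_dist_def quotient_norm_def infdist_notempty dist_norm image_image)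
qed

lemma Metric_space_quotient:
  assumes Y: "subspace Y" and cl: "closed Y"
  shows "Metric_space (cosets Y) quotient_dist"
proof -
  have ne: "Y \<noteq> {}" using subspace_0[OF Y] by blast
  have neg: "infdist (- x) Y = infdist x Y" for x
  proof -
    have *: "Y = uminus ` Y"
    proof (intro set_eqI iffI)
      fix z assume "z \<in> Y"
      then show "z \<in> uminus ` Y" using subspace_neg[OF Y] by (intro image_eqI[of _ _ "- z"]) auto
    qed (use subspace_neg[OF Y] in auto)
    have "(INF a\<in>Y. dist (- x) a) = (INF a\<in>uminus ` Y. dist (- x) a)" using * by simp
    also have "\<dots> = (INF a\<in>Y. dist x a)" by (simp add: image_image dist_minus)
    finally show ?thesis using ne by (simp add: infdist_notempty)
  qed
  have tri: "infdist (x + z) Y \<le> infdist x Y + infdist z Y" for x z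
  proof (rule field_le_epsilon)
    fix e :: real assume "e > 0"
    have *: "\<exists>a\<in>Y. dist u a < infdist u Y + e / 2" for u
      using ne cInf_lessD[of "dist u ` Y" "infdist u Y + e / 2"] \<open>e > 0\<close>
      by (auto simp: infdist_notempty)
    obtain a b where ab: "a \<in> Y" "b \<in> Y" "dist x a < infdist x Y + e / 2"
      "dist z b < infdist z Y + e / 2" using *[of x] *[of z] by blast
    have "infdist (x + z) Y \<le> dist (x + z) (a + b)"
      using ab subspace_add[OF Y] by (intro infdist_le) auto
    also have "\<dots> \<le> dist x a + dist z b" by (rule dist_triangle_add)
    finally show "infdist (x + z) Y \<le> infdist x Y + infdist z Y + e" using ab by linarith
  qed
  show ?thesis
  proof
    show "0 \<le> quotient_dist C D" for C D :: "'a set"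
      by (simp add: quotient_dist_def quotient_norm_def infdist_nonneg)
  next
    show "quotient_dist C D = quotient_dist D C" for C D :: "'a set"
    proof -
      have "norm ` {c - d |c d. c \<in> C \<and> d \<in> D} = norm ` {c - d |c d. c \<in> D \<and> d \<in> C}"
        by (force simp: image_iff norm_minus_commute)
      moreover have "{c - d |c d. c \<in> C \<and> d \<in> D} = {} \<longleftrightarrow> {c - d |c d. c \<in> D \<and> d \<in> C} = {}"
        by blast
      ultimately show ?thesis
        unfolding quotient_dist_def quotient_norm_def infdist_def dist_0_norm by presburger
    qed
  next
    fix C D assume "C \<in> cosets Y" "D \<in> cosets Y"
    then obtain x y where xy: "C = (+) x ` Y" "D = (+) y ` Y" by (auto simp: cosets_alt[OF Y])
    have "(infdist (x - y) Y = 0) = (x - y \<in> Y)"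
      using in_closed_iff_infdist_zero[OF cl ne] by simp
    also have "\<dots> = (C = D)"
    proof
      assume *: "x - y \<in> Y"
      show "C = D" unfolding xy
      proof (intro set_eqI iffI)
        fix z assume "z \<in> (+) x ` Y"
        then show "z \<in> (+) y ` Y"
          using * subspace_add[OF Y *] by (auto intro!: image_eqI[of _ _ "x - y + _"])
      next
        fix z assume "z \<in> (+) y ` Y"
        then obtain w where "w \<in> Y" "z = y + w" by blast
        then show "z \<in> (+) x ` Y"
          using subspace_diff[OF Y _ *] by (intro image_eqI[of _ _ "w - (x - y)"]) auto
      qed
    next
      assume "C = D"
      then have "x + 0 \<in> (+) y ` Y" using xy subspace_0[OF Y] by blast
      then show "x - y \<in> Y" by auto
    qed
    finally show "(quotient_dist C D = 0) = (C = D)" by (simp add: xy quotient_dist_cosets[OF Y])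
  next
    fix C D F assume "C \<in> cosets Y" "D \<in> cosets Y" "F \<in> cosets Y"
    then obtain x y z where "C = (+) x ` Y" "D = (+) y ` Y" "F = (+) z ` Y"
      by (auto simp: cosets_alt[OF Y])
    then show "quotient_dist C F \<le> quotient_dist C D + quotient_dist D F"
      using tri[of "x - y" "y - z"] by (simp add: quotient_dist_cosets[OF Y])
  qed
qed

text \<open>Isomorphic copies do not matter, but a formula cannot quantify over types: the separable
  Banach spaces \<open>X\<close> range over those on a type passed as parameter, which is to be left arbitrary.
  The Banach space \<open>E\<close> is given as a closed subspace of an ambient Banach space. The subspace \<open>Y\<close>
  is not required to be closed.\<close>

definition separably_injective ::
    "'z::banach itself \<Rightarrow> real \<Rightarrow> ('k::real_or_complex \<Rightarrow> 'e::banach \<Rightarrow> 'e) \<Rightarrow> 'e set \<Rightarrow> bool" where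
  "separably_injective Z l t E \<longleftrightarrow>
     banach_space t \<and> module.subspace t E \<and> closed E \<and>
     (separable_space (euclidean :: 'z topology) \<longrightarrow>
       (\<forall>s :: 'k \<Rightarrow> 'z \<Rightarrow> 'z. banach_space s \<longrightarrow>
         (\<forall>Y T. module.subspace s Y \<and> bounded_operator_on s t Y E T \<longrightarrow>
           (\<exists>T'. bounded_operator_on s t UNIV E T' \<and> (\<forall>y\<in>Y. T' y = T y) \<and>
                 onorm_on UNIV T' \<le> l * onorm_on Y T))))"

definition ideal_on_omega :: "nat set set \<Rightarrow> bool" where
  "ideal_on_omega I \<longleftrightarrow>
     {} \<in> I \<and> (\<forall>A\<in>I. \<forall>B. B \<subseteq> A \<longrightarrow> B \<in> I) \<and> (\<forall>A\<in>I. \<forall>B\<in>I. A \<union> B \<in> I) \<and>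
     (\<forall>A. finite A \<longrightarrow> A \<in> I)"

text \<open>As \<^typ>\<open>nat\<close> is discrete, \<^typ>\<open>nat \<Rightarrow>\<^sub>C 'k\<close> consists of all bounded sequences and carries
  the sup norm.\<close>

text \<open>The library states completeness only for metric domains, and \<^typ>\<open>nat\<close> is none.\<close>

instance bcontfun :: (topological_space, complete_space) complete_space
proof
  fix f :: "nat \<Rightarrow> ('a, 'b) bcontfun"
  assume "Cauchy f"
  then obtain g where "uniform_limit UNIV f g sequentially"
    using uniformly_convergent_eq_cauchy[of "\<lambda>_. True" f]
    unfolding Cauchy_def uniform_limit_sequentially_iff
    by (metis dist_fun_lt_imp_dist_val_lt)
  from uniform_limit_bcontfunE[OF this sequentially_bot]
  obtain l where "f \<longlonglongrightarrow> l" by metis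
  then show "convergent f" by (rule convergentI)
qed

instance bcontfun :: (topological_space, banach) banach ..

definition scale_linf :: "'k::real_or_complex \<Rightarrow> (nat \<Rightarrow>\<^sub>C 'k) \<Rightarrow> (nat \<Rightarrow>\<^sub>C 'k)" where
  "scale_linf c x = Bcontfun (\<lambda>n. c * apply_bcontfun x n)"

lemma apply_scale_linf: "apply_bcontfun (scale_linf c x) n = c * apply_bcontfun x n"
proof -
  have "(\<lambda>n. c * apply_bcontfun x n) \<in> bcontfun"
    by (rule bcontfun_normI[where b = "norm c * norm x"])
      (auto simp: norm_mult intro!: continuous_intros mult_left_mono norm_bounded)
  then show ?thesis by (simp add: scale_linf_def Bcontfun_inverse)
qed

lemma banach_space_scale_linf: "banach_space (scale_linf :: 'k::real_or_complex \<Rightarrow> _)"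
proof
  fix c :: 'k and x :: "nat \<Rightarrow>\<^sub>C 'k"
  show "norm (scale_linf c x) = norm c * norm x"
  proof (rule antisym)
    show *: "norm (scale_linf c x) \<le> norm c * norm x" for c and x :: "nat \<Rightarrow>\<^sub>C 'k"
      by (rule norm_bound) (simp add: apply_scale_linf norm_mult mult_left_mono norm_bounded)
    show "norm c * norm x \<le> norm (scale_linf c x)"
    proof (cases "c = 0")
      case False
      have "scale_linf (inverse c) (scale_linf c x) = x"
        using False by (intro bcontfun_eqI) (simp add: apply_scale_linf)
      then show ?thesis
        using *[of "inverse c" "scale_linf c x"] False by (simp add: norm_divide field_simps)
    qed simp
  qed
qed (auto intro!: bcontfun_eqI simp: apply_scale_linf algebra_simps scaleR_conv_of_real)

definition c0_ideal :: "nat set set \<Rightarrow> (nat \<Rightarrow>\<^sub>C 'k::real_or_complex) set" where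
  "c0_ideal I = {x. \<forall>\<epsilon>>0. {n. norm (apply_bcontfun x n) \<ge> \<epsilon>} \<in> I}"

end

theory Submission
  imports Defs
begin

text \<open>The coordinates of \<open>T\<close> are functionals of norm at most \<open>M = \<parallel>T\<parallel>\<close> on \<open>Y\<close>, which tend to \<open>0\<close>
  pointwise along the filter dual to the ideal. Extend them to functionals \<open>R n\<close> of norm at most
  \<open>M\<close> on \<open>X\<close> by the Hahn-Banach theorem. Along this filter, the pointwise cluster points of the
  \<open>R n\<close> annihilate \<open>Y\<close> and have norm at most \<open>M\<close>; hence, by Tychonoff's theorem, on any finite set
  the \<open>R n\<close> are eventually close to functionals of this kind. A countable set that is dense modulo
  \<open>Y\<close> and a diagonal argument give such functionals \<open>G n\<close> with \<open>R n - G n\<close> tending to \<open>0\<close>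
  pointwise on \<open>X\<close>, and \<open>R n - G n\<close> are the coordinates of the extension, of norm at most \<open>2 * M\<close>.\<close>

subsection \<open>The Hahn-Banach theorem\<close>

definition sublinear :: "('a::real_vector \<Rightarrow> real) \<Rightarrow> bool" where
  "sublinear p \<longleftrightarrow> (\<forall>x y. p (x + y) \<le> p x + p y) \<and> (\<forall>c\<ge>0. \<forall>x. p (c *\<^sub>R x) = c * p x)"

lemma sublinear_add: "sublinear p \<Longrightarrow> p (x + y) \<le> p x + p y"
  by (simp add: sublinear_def)

lemma sublinear_scale: "sublinear p \<Longrightarrow> 0 \<le> c \<Longrightarrow> p (c *\<^sub>R x) = c * p x"
  by (simp add: sublinear_def)

lemma sublinear_0: "sublinear p \<Longrightarrow> p 0 = 0"
  using sublinear_scale[of p 0 0] by simp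

lemma sublinear_minus: "sublinear p \<Longrightarrow> - p (- x) \<le> p x"
  using sublinear_add[of p x "- x"] by (simp add: sublinear_0)

text \<open>For positive \<open>c\<close>, the assumed inequality with \<open>inverse c\<close> at
  the point \<open>c *\<^sub>R x\<close> is the converse inequality. So one direction suffices,
  which suits functionals defined as infima.\<close>

lemma sublinearI:
  assumes "\<And>x y. p (x + y) \<le> p x + p y" and "p 0 = 0"
    and le: "\<And>c x. 0 < c \<Longrightarrow> p (c *\<^sub>R x) \<le> c * p x"
  shows "sublinear p"
proof -
  have "p (c *\<^sub>R x) = c * p x" if "0 \<le> c" for c x
  proof (cases "c = 0")
    case False
    with that have c: "0 < c" by simp
    have "p x \<le> inverse c * p (c *\<^sub>R x)" using le[of "inverse c" "c *\<^sub>R x"] c by simp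
    then have "c * p x \<le> p (c *\<^sub>R x)" using c by (simp add: field_simps)
    with le[OF c, of x] show ?thesis by simp
  qed (simp add: assms(2))
  with assms(1) show ?thesis by (simp add: sublinear_def)
qed

text \<open>Taking for \<open>C\<close> the graph of a functional on a subspace, any linear functional below \<open>q\<close>
  extends it; taking a ray shows that a minimal sublinear functional is odd, hence linear.\<close>

lemma sublinear_below_cone:
  fixes p :: "'a::real_vector \<Rightarrow> real" and C :: "('a \<times> real) set"
  assumes p: "sublinear p" and C0: "(0, 0) \<in> C"
    and Cadd: "\<And>u v. u \<in> C \<Longrightarrow> v \<in> C \<Longrightarrow> u + v \<in> C"
    and Cscale: "\<And>c u. 0 < c \<Longrightarrow> u \<in> C \<Longrightarrow> c *\<^sub>R u \<in> C"
    and Cle: "\<And>y a. (y, a) \<in> C \<Longrightarrow> a \<le> p y"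
  obtains q where "sublinear q" "q \<le> p" "\<And>y a. (y, a) \<in> C \<Longrightarrow> q (- y) \<le> - a"
proof -
  \<comment> \<open>This is the largest sublinear functional with the two required properties: any
    such \<open>r\<close> satisfies \<open>r z \<le> r (z + y) + r (- y) \<le> p (z + y) - a\<close>
    for \<open>(y, a)\<close> in \<open>C\<close>.\<close>
  define q where "q z = (INF u\<in>C. p (z + fst u) - snd u)" for z
  have lower: "- p (- z) \<le> p (z + fst u) - snd u" if "u \<in> C" for z u
  proof -
    have "snd u \<le> p (fst u)" using Cle[of "fst u" "snd u"] that by simp
    also have "\<dots> \<le> p (z + fst u) + p (- z)" using sublinear_add[OF p, of "z + fst u" "- z"] by simp
    finally show ?thesis by simp
  qed
  have bdd: "bdd_below ((\<lambda>u. p (z + fst u) - snd u) ` C)" for z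
    using lower by (intro bdd_belowI2) blast
  have ne: "C \<noteq> {}" using C0 by blast
  have le: "q z \<le> p (z + fst u) - snd u" if "u \<in> C" for z u
    unfolding q_def by (rule cINF_lower[OF bdd that])
  have ge: "b \<le> q z" if "\<And>u. u \<in> C \<Longrightarrow> b \<le> p (z + fst u) - snd u" for b z
    unfolding q_def by (rule cINF_greatest[OF ne that])
  have "q (x + y) \<le> q x + q y" for x y
  proof -
    \<comment> \<open>The two infima are taken one at a time: over \<open>v\<close> with
      \<open>u\<close> fixed, then over \<open>u\<close>.\<close>
    have "q (x + y) - q y \<le> p (x + fst u) - snd u" if u: "u \<in> C" for u
    proof -
      have "q (x + y) - (p (x + fst u) - snd u) \<le> p (y + fst v) - snd v" if v: "v \<in> C" for v
        using le[OF Cadd[OF u v], of "x + y"] sublinear_add[OF p, of "x + fst u" "y + fst v"]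
        by (simp add: algebra_simps)
      from ge[OF this] show ?thesis by simp
    qed
    from ge[OF this] show ?thesis by simp
  qed
  moreover have "q 0 = 0"
    using le[OF C0, of 0] ge[of 0 0] Cle sublinear_0[OF p] by force
  moreover have "q (c *\<^sub>R x) \<le> c * q x" if c: "0 < c" for c x
  proof -
    have "q (c *\<^sub>R x) / c \<le> p (x + fst u) - snd u" if u: "u \<in> C" for u
    proof -
      have "q (c *\<^sub>R x) \<le> c * (p (x + fst u) - snd u)"
        using le[OF Cscale[OF c u], of "c *\<^sub>R x"] sublinear_scale[OF p, of c "x + fst u"] c
        by (simp add: algebra_simps)
      with c show ?thesis by (simp add: divide_le_eq mult.commute)
    qed
    from ge[OF this] c show ?thesis by (simp add: divide_le_eq mult.commute)
  qed
  ultimately have "sublinear q" by (rule sublinearI)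
  moreover have "q \<le> p" using le[OF C0] by (simp add: le_fun_def)
  moreover have "q (- y) \<le> - a" if "(y, a) \<in> C" for y a
    using le[OF that, of "- y"] by (simp add: sublinear_0[OF p])
  ultimately show thesis by (rule that)
qed

text \<open>This is the bound of a chain in Zorn's lemma, namely the pointwise infimum. It is finite
  because \<open>- p0 (- x) \<le> - p (- x) \<le> p x\<close> for every member
  \<open>p\<close>.\<close>

lemma sublinear_chain_INF:
  fixes C :: "('a::real_vector \<Rightarrow> real) set"
  assumes ne: "C \<noteq> {}" and sub: "\<And>p. p \<in> C \<Longrightarrow> sublinear p" and le: "\<And>p. p \<in> C \<Longrightarrow> p \<le> p0"
    and chain: "\<And>p q. p \<in> C \<Longrightarrow> q \<in> C \<Longrightarrow> p \<le> q \<or> q \<le> p"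
  obtains u where "sublinear u" "\<And>p. p \<in> C \<Longrightarrow> u \<le> p"
proof -
  define u where "u x = (INF p\<in>C. p x)" for x
  have lower: "- p0 (- x) \<le> p x" if "p \<in> C" for p x
    using sublinear_minus[OF sub[OF that], of x] le[OF that] by (fastforce dest: le_funD[of _ _ "- x"])
  have bdd: "bdd_below ((\<lambda>p. p x) ` C)" for x using lower by (intro bdd_belowI2) blast
  have lo: "u x \<le> p x" if "p \<in> C" for p x unfolding u_def by (rule cINF_lower[OF bdd that])
  have ge: "b \<le> u x" if "\<And>p. p \<in> C \<Longrightarrow> b \<le> p x" for b x
    unfolding u_def by (rule cINF_greatest[OF ne that])
  have "u (x + y) \<le> u x + u y" for x y
  proof -
    have "u (x + y) - u y \<le> p x" if p: "p \<in> C" for p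
    proof -
      \<comment> \<open>The smaller of \<open>p\<close> and \<open>q\<close>, say \<open>r\<close>,
        gives \<open>u (x + y) \<le> r x + r y \<le> p x + q y\<close>. This is where the chain
        condition enters.\<close>
      have "u (x + y) - p x \<le> q y" if q: "q \<in> C" for q
        using chain[OF p q] lo[OF p, of "x + y"] lo[OF q, of "x + y"]
          sublinear_add[OF sub[OF p], of x y] sublinear_add[OF sub[OF q], of x y]
        by (fastforce dest: le_funD[of _ _ x] le_funD[of _ _ y])
      then have "u (x + y) - p x \<le> u y" by (rule ge)
      then show ?thesis by simp
    qed
    then have "u (x + y) - u y \<le> u x" by (rule ge)
    then show ?thesis by simp
  qed
  moreover have "u 0 = 0" using ne sub by (simp add: u_def sublinear_0 cong: INF_cong)
  moreover have "u (c *\<^sub>R x) \<le> c * u x" if c: "0 < c" for c x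
  proof -
    have "u (c *\<^sub>R x) / c \<le> p x" if "p \<in> C" for p
      using lo[OF that, of "c *\<^sub>R x"] sublinear_scale[OF sub[OF that], of c x] c
      by (simp add: divide_le_eq mult.commute)
    from ge[OF this] c show ?thesis by (simp add: divide_le_eq mult.commute)
  qed
  ultimately have "sublinear u" by (rule sublinearI)
  with lo show thesis by (intro that) (auto simp: le_fun_def)
qed

text \<open>Zorn's lemma yields a minimal sublinear functional below \<open>p0\<close>. Minimality
  makes it odd, and an odd sublinear functional is linear.\<close>

lemma sublinear_dominates_linear:
  fixes p0 :: "'a::real_vector \<Rightarrow> real"
  assumes p0: "sublinear p0"
  obtains m where "linear m" "m \<le> p0"
proof -
  \<comment> \<open>The order \<open>?P\<close> is reversed, so that a maximal element is a minimal
    functional.\<close>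
  let ?A = "{p. sublinear p \<and> p \<le> p0}" and ?P = "\<lambda>p q :: 'a \<Rightarrow> real. q \<le> p"
  have "\<exists>m\<in>?A. \<forall>p\<in>?A. ?P m p \<longrightarrow> p = m"
  proof (rule predicate_Zorn)
    show "partial_order_on ?A (relation_of ?P ?A)"
      by (rule partial_order_on_relation_ofI) auto
  next
    fix C assume "C \<in> Chains (relation_of ?P ?A)"
    then have chain: "p \<le> q \<or> q \<le> p" and sub: "sublinear p" and le: "p \<le> p0"
      if "p \<in> C" "q \<in> C" for p q
      using that by (auto simp: Chains_def relation_of_def)
    show "\<exists>u\<in>?A. \<forall>p\<in>C. ?P p u"
    proof (cases "C = {}")
      case False
      obtain u where "sublinear u" "\<And>p. p \<in> C \<Longrightarrow> u \<le> p"
        by (rule sublinear_chain_INF[OF False, of p0]) (use chain sub le in auto)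
      with False le show ?thesis by (blast intro: order_trans)
    qed (use p0 in auto)
  qed
  then obtain m where m: "sublinear m" "m \<le> p0"
    and min: "\<And>p. sublinear p \<Longrightarrow> p \<le> m \<Longrightarrow> p = m"
    by (auto intro: order_trans)
  have odd: "m (- x) = - m x" for x
  proof -
    let ?C = "(\<lambda>t. (t *\<^sub>R x, t * m x)) ` {0..}"
    obtain q where q: "sublinear q" "q \<le> m" "\<And>y a. (y, a) \<in> ?C \<Longrightarrow> q (- y) \<le> - a"
    proof (rule sublinear_below_cone[OF m(1), of ?C])
      show "(0, 0) \<in> ?C" by (rule image_eqI[of _ _ 0]) auto
      show "u + v \<in> ?C" if "u \<in> ?C" "v \<in> ?C" for u v
      proof -
        from that obtain s t where "u = (s *\<^sub>R x, s * m x)" "v = (t *\<^sub>R x, t * m x)" "0 \<le> s" "0 \<le> t"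
          by auto
        then show ?thesis by (intro image_eqI[of _ _ "s + t"]) (auto simp: algebra_simps)
      qed
      show "c *\<^sub>R u \<in> ?C" if "0 < c" "u \<in> ?C" for c u
      proof -
        from that obtain t where "u = (t *\<^sub>R x, t * m x)" "0 \<le> t" by auto
        with that show ?thesis by (intro image_eqI[of _ _ "c * t"]) auto
      qed
      show "a \<le> m y" if "(y, a) \<in> ?C" for y a
        using that sublinear_scale[OF m(1)] by auto
    qed blast
    \<comment> \<open>By minimality \<open>q = m\<close>, so the property of \<open>q\<close> at the
      point of the ray with parameter 1 is the missing half of oddness.\<close>
    have "(x, m x) \<in> ?C" by (rule image_eqI[of _ _ 1]) auto
    from q(3)[OF this] have "m (- x) \<le> - m x" using min[OF q(1,2)] by simp
    with sublinear_minus[OF m(1), of x] show ?thesis by simp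
  qed
  \<comment> \<open>At \<open>- x\<close> and \<open>- y\<close>, subadditivity combined with
    oddness becomes superadditivity.\<close>
  have "m (x + y) = m x + m y" for x y
    using sublinear_add[OF m(1), of x y] sublinear_add[OF m(1), of "- x" "- y"] odd[of "x + y"]
    by (simp add: odd)
  moreover have "m (c *\<^sub>R x) = c *\<^sub>R m x" for c x
    using sublinear_scale[OF m(1), of c x] sublinear_scale[OF m(1), of "- c" x] odd[of "c *\<^sub>R x"]
    by (cases "0 \<le> c") auto
  ultimately have "linear m" by (rule linearI)
  with m(2) show thesis by (rule that[rotated])
qed

text \<open>With the graph of \<open>f\<close> as cone, a linear \<open>g\<close> below
  \<open>q\<close> has \<open>g (- y) \<le> - f y\<close>, hence \<open>f \<le> g\<close> on
  \<open>Y\<close>. Replacing \<open>y\<close> by \<open>- y\<close> turns this into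
  equality.\<close>

theorem hahn_banach_sublinear:
  fixes p :: "'a::real_vector \<Rightarrow> real"
  assumes p: "sublinear p" and Y: "subspace Y"
    and fadd: "\<And>x y. x \<in> Y \<Longrightarrow> y \<in> Y \<Longrightarrow> f (x + y) = f x + f y"
    and fscale: "\<And>c x. x \<in> Y \<Longrightarrow> f (c *\<^sub>R x) = c * f x"
    and fle: "\<And>y. y \<in> Y \<Longrightarrow> f y \<le> p y"
  obtains g where "linear g" "\<And>x. g x \<le> p x" "\<And>y. y \<in> Y \<Longrightarrow> g y = f y"
proof -
  let ?C = "(\<lambda>y. (y, f y)) ` Y"
  have f0: "f 0 = 0" using fscale[OF subspace_0[OF Y], of 0] by simp
  obtain q where q: "sublinear q" "q \<le> p" "\<And>y a. (y, a) \<in> ?C \<Longrightarrow> q (- y) \<le> - a"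
  proof (rule sublinear_below_cone[OF p, of ?C])
    show "(0, 0) \<in> ?C" using f0 subspace_0[OF Y] by (intro image_eqI[of _ _ 0]) auto
    show "u + v \<in> ?C" if "u \<in> ?C" "v \<in> ?C" for u v
      using that fadd subspace_add[OF Y] by (auto intro!: image_eqI)
    show "c *\<^sub>R u \<in> ?C" if "u \<in> ?C" for c u
      using that fscale subspace_scale[OF Y] by (auto intro!: image_eqI)
    show "a \<le> p y" if "(y, a) \<in> ?C" for y a using that fle by auto
  qed blast
  obtain g where g: "linear g" "g \<le> q" by (rule sublinear_dominates_linear[OF q(1)])
  have ge: "f y \<le> g y" if "y \<in> Y" for y
    using q(3)[of y "f y"] that le_funD[OF g(2), of "- y"] linear_neg[OF g(1), of y] by auto
  have "g y = f y" if y: "y \<in> Y" for y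
    using ge[OF y] ge[OF subspace_neg[OF Y y]] fscale[OF y, of "- 1"] linear_neg[OF g(1), of y] by simp
  moreover have "g x \<le> p x" for x using le_funD[OF g(2), of x] le_funD[OF q(2), of x] by simp
  ultimately show thesis using g(1) by (intro that)
qed

corollary hahn_banach_norm:
  fixes f :: "'a::real_normed_vector \<Rightarrow> real"
  assumes Y: "subspace Y" and M: "0 \<le> M"
    and fadd: "\<And>x y. x \<in> Y \<Longrightarrow> y \<in> Y \<Longrightarrow> f (x + y) = f x + f y"
    and fscale: "\<And>c x. x \<in> Y \<Longrightarrow> f (c *\<^sub>R x) = c * f x"
    and fle: "\<And>y. y \<in> Y \<Longrightarrow> \<bar>f y\<bar> \<le> M * norm y"
  obtains g where "linear g" "\<And>x. \<bar>g x\<bar> \<le> M * norm x" "\<And>y. y \<in> Y \<Longrightarrow> g y = f y"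
proof -
  have "sublinear (\<lambda>x::'a. M * norm x)"
    using M by (auto simp: sublinear_def norm_triangle_ineq mult_left_mono simp flip: distrib_left)
  then obtain g where g: "linear g" "\<And>x. g x \<le> M * norm x" "\<And>y. y \<in> Y \<Longrightarrow> g y = f y"
    by (rule hahn_banach_sublinear[OF _ Y, where f = f]) (use fadd fscale fle in \<open>auto simp: abs_le_iff\<close>)
  have "\<bar>g x\<bar> \<le> M * norm x" for x
    using g(2)[of x] g(2)[of "- x"] linear_neg[OF g(1), of x] by auto
  with g show thesis by (intro that)
qed

subsection \<open>Extension of pointwise null sequences of functionals\<close>

text \<open>This replaces the choice of a convergent subsequence, since a compact set of functions
  need not be sequentially compact. The filter \<open>H\<close> refines \<open>F\<close> by the
  preimages of the neighbourhoods of a cluster point.\<close>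

lemma compact_cluster_filter:
  assumes "compact U" and F: "F \<noteq> bot" and U: "eventually (\<lambda>n. f n \<in> U) F"
  obtains l H where "l \<in> U" "H \<le> F" "H \<noteq> bot" "(f \<longlongrightarrow> l) H"
proof -
  have "filtermap f F \<noteq> bot" "eventually (\<lambda>x. x \<in> U) (filtermap f F)"
    using F U by (auto simp: filtermap_bot_iff eventually_filtermap)
  with \<open>compact U\<close> obtain l where l: "l \<in> U" "inf (nhds l) (filtermap f F) \<noteq> bot"
    unfolding compact_filter by blast
  let ?H = "inf (filtercomap f (nhds l)) F"
  \<comment> \<open>Otherwise the \<open>f n\<close> would eventually avoid some neighbourhood of
    \<open>l\<close> along \<open>F\<close>, although \<open>l\<close> is a cluster point.\<close>
  have "?H \<noteq> bot"
  proof
    assume "?H = bot"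
    then obtain P Q where "eventually P (filtercomap f (nhds l))" "eventually Q F" "\<And>n. P n \<Longrightarrow> Q n \<Longrightarrow> False"
      unfolding trivial_limit_def eventually_inf by blast
    then obtain P' where P': "eventually P' (nhds l)" "\<And>n. P' (f n) \<Longrightarrow> Q n \<Longrightarrow> False"
      unfolding eventually_filtercomap by blast
    have "eventually (\<lambda>x. \<not> P' x) (filtermap f F)"
      unfolding eventually_filtermap using \<open>eventually Q F\<close> by eventually_elim (use P'(2) in blast)
    with P'(1) l(2) show False unfolding trivial_limit_def eventually_inf by blast
  qed
  moreover have "(f \<longlongrightarrow> l) ?H"
    by (metis filterlim_iff_le_filtercomap inf_le1)
  ultimately show thesis using l(1) by (intro that[of l ?H]) auto
qed

text \<open>Tychonoff's theorem: the topology of the function type is that of pointwise convergence,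
  and the set is a product of compact intervals.\<close>

lemma compact_bounded_functions:
  "compact {g :: 'a \<Rightarrow> real. \<forall>x. \<bar>g x\<bar> \<le> b x}"
proof -
  have "compactin (product_topology (\<lambda>_. euclidean) UNIV) (\<Pi>\<^sub>E x\<in>UNIV. {- b x..b x})"
    by (subst compactin_PiE) simp
  moreover have "(\<Pi>\<^sub>E x\<in>UNIV. {- b x..b x}) = {g. \<forall>x. \<bar>g x\<bar> \<le> b x}"
    by (auto simp: PiE_UNIV_domain abs_le_iff minus_le_iff)
  ultimately show ?thesis by (simp add: euclidean_product_topology)
qed

text \<open>The index at \<open>n\<close> is the largest \<open>k \<le> n\<close> with
  \<open>P k n\<close>. The bound by \<open>n\<close> makes the maximum exist, and each fixed
  \<open>k\<close> eventually satisfies it because \<open>F\<close> is finer than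
  \<open>sequentially\<close>.\<close>

lemma eventually_diagonal_index:
  fixes P :: "nat \<Rightarrow> nat \<Rightarrow> bool"
  assumes F: "F \<le> sequentially" and P: "\<And>k. eventually (P k) F"
  obtains \<kappa> where "filterlim \<kappa> at_top F" "eventually (\<lambda>n. P (\<kappa> n) n) F"
proof -
  define \<kappa> where "\<kappa> n = (GREATEST k. k \<le> n \<and> P k n)" for n
  have *: "k \<le> \<kappa> n \<and> P (\<kappa> n) n" if "k \<le> n" "P k n" for k n
    using that Greatest_le_nat[of "\<lambda>k. k \<le> n \<and> P k n" k n] GreatestI_nat[of "\<lambda>k. k \<le> n \<and> P k n" k n]
    by (auto simp: \<kappa>_def)
  have "eventually (\<lambda>n. k \<le> \<kappa> n \<and> P (\<kappa> n) n) F" for k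
    using filter_leD[OF F eventually_ge_at_top[of k]] P[of k] by eventually_elim (rule *)
  then show thesis
    by (intro that[of \<kappa>]) (auto simp: filterlim_at_top eventually_conj_iff)
qed

text \<open>Otherwise a cluster point of the \<open>R n\<close> along the exceptional \<open>n\<close> would serve as \<open>G\<close>.\<close>

lemma eventually_near_annihilator:
  fixes R :: "nat \<Rightarrow> 'a::real_normed_vector \<Rightarrow> real"
  assumes lin: "\<And>n. linear (R n)" and le: "\<And>n x. \<bar>R n x\<bar> \<le> M * norm x"
    and null: "\<And>y. y \<in> Y \<Longrightarrow> ((\<lambda>n. R n y) \<longlongrightarrow> 0) F"
    and S: "finite S" and e: "0 < e"
  shows "eventually (\<lambda>n. \<exists>G. linear G \<and> (\<forall>x. \<bar>G x\<bar> \<le> M * norm x) \<and> (\<forall>y\<in>Y. G y = 0) \<and>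
           (\<forall>x\<in>S. \<bar>R n x - G x\<bar> < e)) F" (is "eventually ?P F")
proof (rule ccontr)
  assume "\<not> eventually ?P F"
  then have ne: "inf F (principal {n. \<not> ?P n}) \<noteq> bot"
    by (simp add: trivial_limit_def eventually_inf_principal)
  obtain G H where G: "G \<in> {g. \<forall>x. \<bar>g x\<bar> \<le> M * norm x}"
    and H: "H \<le> inf F (principal {n. \<not> ?P n})" "H \<noteq> bot" "(R \<longlongrightarrow> G) H"
    by (rule compact_cluster_filter[OF compact_bounded_functions ne, of R "\<lambda>x. M * norm x"])
      (use le in auto)
  \<comment> \<open>Convergence in the product topology is convergence at each point.\<close>
  have lim: "((\<lambda>n. R n x) \<longlongrightarrow> G x) H" for x
    using H(3) unfolding limitin_canonical_iff[symmetric] euclidean_product_topology[symmetric]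
      limitin_componentwise by simp
  have "linear G"
  proof (rule linearI)
    show "G (x + y) = G x + G y" for x y
      using tendsto_unique[OF H(2) lim[of "x + y"]] tendsto_add[OF lim[of x] lim[of y]]
      by (simp add: linear_add[OF lin])
    show "G (c *\<^sub>R x) = c *\<^sub>R G x" for c x
      using tendsto_unique[OF H(2) lim[of "c *\<^sub>R x"]] tendsto_scaleR[OF tendsto_const lim[of x], of c]
      by (simp add: linear_scale[OF lin])
  qed
  moreover have "G y = 0" if "y \<in> Y" for y
    using tendsto_unique[OF H(2) lim] tendsto_mono[OF _ null[OF that], of H] H(1) by simp
  \<comment> \<open>Finiteness of \<open>S\<close> turns pointwise convergence into one simultaneous
    estimate.\<close>
  moreover have "eventually (\<lambda>n. \<forall>x\<in>S. \<bar>R n x - G x\<bar> < e) H"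
    using S lim e by (auto simp: eventually_ball_finite_distrib tendsto_iff dist_real_def)
  ultimately have "eventually ?P H"
    using G by (auto elim!: eventually_mono)
  moreover have "eventually (\<lambda>n. \<not> ?P n) H"
    using H(1) by (auto simp: le_principal)
  ultimately have "eventually (\<lambda>_. False) H" by eventually_elim blast
  with H(2) show False by (simp add: trivial_limit_def)
qed

theorem extend_null_sequence_real:
  fixes f :: "nat \<Rightarrow> 'a::real_normed_vector \<Rightarrow> real"
  assumes F: "F \<le> sequentially" and Y: "subspace Y" and M: "0 \<le> M"
    and fadd: "\<And>n x y. x \<in> Y \<Longrightarrow> y \<in> Y \<Longrightarrow> f n (x + y) = f n x + f n y"
    and fscale: "\<And>n c x. x \<in> Y \<Longrightarrow> f n (c *\<^sub>R x) = c * f n x"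
    and fle: "\<And>n y. y \<in> Y \<Longrightarrow> \<bar>f n y\<bar> \<le> M * norm y"
    and null: "\<And>y. y \<in> Y \<Longrightarrow> ((\<lambda>n. f n y) \<longlongrightarrow> 0) F"
    and D: "countable D" and dense: "\<And>x e. 0 < e \<Longrightarrow> \<exists>d\<in>D. \<exists>y\<in>Y. norm (x - d - y) < e"
  obtains S where "\<And>n. linear (S n)" "\<And>n x. \<bar>S n x\<bar> \<le> 2 * M * norm x"
    "\<And>n y. y \<in> Y \<Longrightarrow> S n y = f n y" "\<And>x. ((\<lambda>n. S n x) \<longlongrightarrow> 0) F"
proof -
  have "\<exists>g. linear g \<and> (\<forall>x. \<bar>g x\<bar> \<le> M * norm x) \<and> (\<forall>y\<in>Y. g y = f n y)" for n
    by (rule hahn_banach_norm[OF Y M, of "f n"]) (use fadd fscale fle in blast)+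
  then obtain R where R: "\<And>n. linear (R n)" "\<And>n x. \<bar>R n x\<bar> \<le> M * norm x"
    "\<And>n y. y \<in> Y \<Longrightarrow> R n y = f n y" by metis
  define d where "d = from_nat_into D"
  have "D \<noteq> {}" using dense[of 1 0] by auto
  then have d: "range d = D" using D by (simp add: d_def range_from_nat_into)
  define K where "K = {G. linear G \<and> (\<forall>x. \<bar>G x\<bar> \<le> M * norm x) \<and> (\<forall>y\<in>Y. G y = 0)}"
  \<comment> \<open>The tolerance shrinks while the set of test points grows, so a diagonal index
    tending to infinity handles every \<open>d i\<close>.\<close>
  define P where "P k n \<longleftrightarrow> (\<exists>G\<in>K. \<forall>i\<le>k. \<bar>R n (d i) - G (d i)\<bar> < inverse (Suc k))" for k n
  have "eventually (P k) F" for k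
  proof -
    have "eventually (\<lambda>n. \<exists>G. linear G \<and> (\<forall>x. \<bar>G x\<bar> \<le> M * norm x) \<and> (\<forall>y\<in>Y. G y = 0) \<and>
            (\<forall>x\<in>d ` {..k}. \<bar>R n x - G x\<bar> < inverse (Suc k))) F"
      by (rule eventually_near_annihilator) (use R null in auto)
    then show ?thesis by eventually_elim (auto simp: P_def K_def)
  qed
  then obtain \<kappa> where \<kappa>: "filterlim \<kappa> at_top F" "eventually (\<lambda>n. P (\<kappa> n) n) F"
    by (rule eventually_diagonal_index[OF F])
  \<comment> \<open>The zero functional is the default where \<open>P (\<kappa> n) n\<close> fails,
    so the norm bound and the vanishing on \<open>Y\<close> hold for every \<open>n\<close>.\<close>
  have "(\<lambda>_. 0) \<in> K" using M by (simp add: K_def module_hom_zero)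
  then have "\<exists>G\<in>K. P (\<kappa> n) n \<longrightarrow> (\<forall>i\<le>\<kappa> n. \<bar>R n (d i) - G (d i)\<bar> < inverse (Suc (\<kappa> n)))" for n
    unfolding P_def by blast
  then obtain G where GK: "\<And>n. G n \<in> K"
    and G: "\<And>n i. P (\<kappa> n) n \<Longrightarrow> i \<le> \<kappa> n \<Longrightarrow> \<bar>R n (d i) - G n (d i)\<bar> < inverse (Suc (\<kappa> n))"
    by metis
  define S where "S n x = R n x - G n x" for n x
  have lin: "linear (S n)" for n
    unfolding S_def using R(1) GK by (intro linear_compose_sub) (auto simp: K_def)
  have le: "\<bar>S n x\<bar> \<le> 2 * M * norm x" for n x
  proof -
    have "\<bar>G n x\<bar> \<le> M * norm x" using GK[of n] by (simp add: K_def)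
    with R(2)[of n x] show ?thesis unfolding S_def by linarith
  qed
  have eq: "S n y = f n y" if "y \<in> Y" for n y
    using GK[of n] R(3) that by (simp add: S_def K_def)
  have null_d: "((\<lambda>n. S n (d i)) \<longlongrightarrow> 0) F" for i
  proof (rule Lim_null_comparison)
    show "((\<lambda>n. inverse (real (Suc (\<kappa> n)))) \<longlongrightarrow> 0) F"
      by (rule filterlim_compose[OF LIMSEQ_inverse_real_of_nat \<kappa>(1)])
    have "eventually (\<lambda>n. i \<le> \<kappa> n) F" using \<kappa>(1) by (simp add: filterlim_at_top)
    with \<kappa>(2) show "eventually (\<lambda>n. norm (S n (d i)) \<le> inverse (real (Suc (\<kappa> n)))) F"
      by eventually_elim (use G in \<open>force simp: S_def\<close>)
  qed
  have "((\<lambda>n. S n x) \<longlongrightarrow> 0) F" for x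
  proof (rule tendstoI)
    fix e :: real assume e: "0 < e"
    \<comment> \<open>Adding 1 keeps the divisor positive when \<open>M = 0\<close>.\<close>
    define c where "c = 2 * M + 1"
    have c: "0 < c" using M by (simp add: c_def)
    obtain i y where y: "y \<in> Y" and xy: "norm (x - d i - y) < e / (2 * c)"
      using dense[of "e / (2 * c)" x] e c d by auto
    \<comment> \<open>Density holds only modulo \<open>Y\<close>, but on \<open>Y\<close> the
      \<open>S n\<close> agree with the null sequence \<open>f n\<close>. The remainder is
      controlled by the uniform norm bound.\<close>
    have "((\<lambda>n. S n (d i) + S n y) \<longlongrightarrow> 0 + 0) F"
      using null[OF y] by (intro tendsto_add null_d) (simp add: eq[OF y])
    then have "eventually (\<lambda>n. \<bar>S n (d i) + S n y\<bar> < e / 2) F"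
      using e by (auto dest!: tendstoD[where e = "e / 2"])
    then show "eventually (\<lambda>n. dist (S n x) 0 < e) F"
    proof eventually_elim
      case (elim n)
      have "S n x = (S n (d i) + S n y) + S n (x - d i - y)"
        by (simp add: linear_diff[OF lin])
      moreover have "\<bar>S n (x - d i - y)\<bar> \<le> c * norm (x - d i - y)"
        using le[of n "x - d i - y"] norm_ge_zero[of "x - d i - y"]
        unfolding c_def distrib_right by linarith
      moreover have "c * norm (x - d i - y) < e / 2"
        using xy c by (simp add: field_simps)
      ultimately show ?case using elim unfolding dist_real_def diff_0_right by linarith
    qed
  qed
  with lin le eq show thesis by (intro that)
qed

subsection \<open>The ideal as a filter\<close>

text \<open>The filter dual to the ideal turns membership in \<open>c0_ideal I\<close> into ordinary
  convergence to 0. For an ideal containing \<open>UNIV\<close> it is \<open>bot\<close>.\<close>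

definition ideal_filter :: "'a set set \<Rightarrow> 'a filter" where
  "ideal_filter I = Abs_filter (\<lambda>P. {n. \<not> P n} \<in> I)"

lemma eventually_ideal_filter:
  assumes "ideal_on_omega I"
  shows "eventually P (ideal_filter I) \<longleftrightarrow> {n. \<not> P n} \<in> I"
  unfolding ideal_filter_def
proof (rule eventually_Abs_filter)
  have down: "A \<in> I \<Longrightarrow> B \<subseteq> A \<Longrightarrow> B \<in> I" and un: "A \<in> I \<Longrightarrow> B \<in> I \<Longrightarrow> A \<union> B \<in> I" for A B
    using assms by (auto simp: ideal_on_omega_def)
  show "is_filter (\<lambda>P. {n. \<not> P n} \<in> I)"
  proof
    show "{n. \<not> True} \<in> I" using assms by (simp add: ideal_on_omega_def)
    show "{n. \<not> (P n \<and> Q n)} \<in> I" if "{n. \<not> P n} \<in> I" "{n. \<not> Q n} \<in> I" for P Q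
      by (rule down[OF un[OF that]]) auto
    show "{n. \<not> Q n} \<in> I" if "\<forall>n. P n \<longrightarrow> Q n" "{n. \<not> P n} \<in> I" for P Q
      by (rule down[OF that(2)]) (use that(1) in auto)
  qed
qed

text \<open>Finite sets belong to the ideal. This is what makes the diagonal argument available
  along its filter.\<close>

lemma ideal_filter_le_sequentially:
  assumes "ideal_on_omega I"
  shows "ideal_filter I \<le> sequentially"
proof (rule filter_leI)
  fix P :: "nat \<Rightarrow> bool" assume "eventually P sequentially"
  then have "finite {n. \<not> P n}"
    by (simp add: cofinite_eq_sequentially[symmetric] eventually_cofinite)
  then show "eventually P (ideal_filter I)"
    using assms by (simp add: eventually_ideal_filter ideal_on_omega_def)
qed

lemma c0_ideal_iff_tendsto:
  assumes "ideal_on_omega I"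
  shows "x \<in> c0_ideal I \<longleftrightarrow> (apply_bcontfun x \<longlongrightarrow> 0) (ideal_filter I)"
  by (simp add: c0_ideal_def tendsto_iff eventually_ideal_filter[OF assms] not_less)

lemma closed_c0_ideal:
  fixes I :: "nat set set"
  assumes I: "ideal_on_omega I"
  shows "closed (c0_ideal I :: (nat \<Rightarrow>\<^sub>C 'k::real_or_complex) set)"
proof -
  have "x \<in> c0_ideal I" if x: "x \<in> closure (c0_ideal I)" for x :: "nat \<Rightarrow>\<^sub>C 'k"
    unfolding c0_ideal_iff_tendsto[OF I]
  proof (rule tendstoI)
    fix e :: real assume e: "0 < e"
    with x obtain y where y: "y \<in> c0_ideal I" and xy: "dist y x < e / 2"
      unfolding closure_approachable by (meson half_gt_zero)
    have "eventually (\<lambda>n. dist (apply_bcontfun y n) 0 < e / 2) (ideal_filter I)"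
      using y e by (auto simp: c0_ideal_iff_tendsto[OF I] dest!: tendstoD[where e = "e / 2"])
    then show "eventually (\<lambda>n. dist (apply_bcontfun x n) 0 < e) (ideal_filter I)"
    proof eventually_elim
      case (elim n)
      have "dist (apply_bcontfun x n) 0 \<le> dist (apply_bcontfun y n) (apply_bcontfun x n) + dist (apply_bcontfun y n) 0"
        by (rule dist_triangle3)
      with dist_bounded[of y n x] xy elim show ?case by linarith
    qed
  qed
  then show ?thesis by (metis closure_subset closure_eq subsetI subset_antisym)
qed

lemma subspace_c0_ideal:
  assumes I: "ideal_on_omega I"
  shows "module.subspace scale_linf (c0_ideal I :: (nat \<Rightarrow>\<^sub>C 'k::real_or_complex) set)"
proof -
  interpret L: banach_space "scale_linf :: 'k \<Rightarrow> _" by (rule banach_space_scale_linf)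
  have "apply_bcontfun 0 = (\<lambda>_. 0 :: 'k)"
    and "apply_bcontfun (x + y) = (\<lambda>n. apply_bcontfun x n + apply_bcontfun y n)"
    and "apply_bcontfun (scale_linf c x) = (\<lambda>n. c * apply_bcontfun x n)"
    for c and x y :: "nat \<Rightarrow>\<^sub>C 'k"
    by (simp_all add: fun_eq_iff zero_bcontfun.rep_eq plus_bcontfun.rep_eq apply_scale_linf)
  then show ?thesis
    by (auto intro!: L.subspaceI tendsto_add_zero tendsto_mult_right_zero
        simp: c0_ideal_iff_tendsto[OF I])
qed

subsection \<open>Real and complex scalars\<close>

text \<open>The map \<open>re\<close> is the real part of the embedding \<open>h\<close>, and
  \<open>j\<close> is the preimage of the imaginary unit; \<open>re (j * c)\<close> is minus the
  imaginary part. Being additive and isometric, \<open>h\<close> is injective, so the decompositions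
  of scalars can be checked in the complex numbers.\<close>

lemma real_or_complex_cases:
  fixes c :: "'k::real_or_complex"
  obtains (real) re where "linear re" "\<And>c :: 'k. \<bar>re c\<bar> \<le> norm c" "\<And>c. c = of_real (re c)"
  | (complex) j re where "linear re" "\<And>c :: 'k. \<bar>re c\<bar> \<le> norm c" "j * j = - 1"
      "\<And>c. c = of_real (re c) - j * of_real (re (j * c))"
      "\<And>a b. (norm (of_real a + j * of_real b))\<^sup>2 = a\<^sup>2 + b\<^sup>2"
proof -
  obtain h :: "'k \<Rightarrow> complex" where add: "\<And>x y. h (x + y) = h x + h y"
    and mult: "\<And>x y. h (x * y) = h x * h y" and sc: "\<And>r. h (scaleR r 1) = complex_of_real r"
    and nrm: "\<And>x. norm (h x) = norm x" and rng: "range h = \<real> \<or> range h = UNIV"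
    using real_or_complex_embedding[where 'a = 'k] by blast
  have diff: "h (x - y) = h x - h y" for x y using add[of "x - y" y] by simp
  have inj: "x = y" if "h x = h y" for x y
    using nrm[of "x - y"] that by (simp add: diff)
  have of_real: "h (of_real r) = of_real r" for r by (simp add: of_real_def[of r, where 'a = 'k] sc)
  have lin: "linear (\<lambda>c. Re (h c))"
    by (auto intro!: linearI simp: add mult of_real scaleR_conv_of_real)
  have le: "\<bar>Re (h c)\<bar> \<le> norm c" for c using abs_Re_le_cmod[of "h c"] nrm by simp
  from rng show thesis
  proof
    assume "range h = \<real>"
    then have "h c \<in> \<real>" for c by blast
    then have "c = of_real (Re (h c))" for c
      by (intro inj) (simp add: of_real of_real_Re)
    with lin le show thesis by (rule real)
  next
    assume "range h = UNIV"
    then obtain j where j: "h j = \<i>" by (metis surjD)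
    show thesis
    proof (rule complex[OF lin le])
      have "h (-1) = -1" using diff[of 0 1] of_real[of 0] of_real[of 1] by simp
      then show "j * j = - 1" by (intro inj) (simp add: mult j)
      show "c = of_real (Re (h c)) - j * of_real (Re (h (j * c)))" for c
        by (rule inj) (simp add: add diff mult j of_real complex_eq_iff)
      show "(norm (of_real a + j * of_real b))\<^sup>2 = a\<^sup>2 + b\<^sup>2" for a b
        unfolding nrm[symmetric] add mult j of_real by (simp add: cmod_power2)
    qed
  qed
qed

lemma (in banach_space) real_subspace:
  assumes Y: "subspace Y"
  shows "Real_Vector_Spaces.subspace Y"
proof (rule Real_Vector_Spaces.subspaceI)
  show "r *\<^sub>R x \<in> Y" if "x \<in> Y" for r x
    using subspace_scale[OF Y that, of "of_real r"] by (simp add: scale_of_real)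
qed (use subspace_0[OF Y] subspace_add[OF Y] in auto)

theorem extend_null_sequence:
  fixes f :: "nat \<Rightarrow> 'a::banach \<Rightarrow> 'k::real_or_complex" and s :: "'k \<Rightarrow> 'a \<Rightarrow> 'a"
  assumes s: "banach_space s" and F: "F \<le> sequentially" and Y: "module.subspace s Y" and M: "0 \<le> M"
    and fadd: "\<And>n x y. x \<in> Y \<Longrightarrow> y \<in> Y \<Longrightarrow> f n (x + y) = f n x + f n y"
    and fscale: "\<And>n c x. x \<in> Y \<Longrightarrow> f n (s c x) = c * f n x"
    and fle: "\<And>n y. y \<in> Y \<Longrightarrow> norm (f n y) \<le> M * norm y"
    and null: "\<And>y. y \<in> Y \<Longrightarrow> ((\<lambda>n. f n y) \<longlongrightarrow> 0) F"
    and D: "countable D" and dense: "\<And>x e. 0 < e \<Longrightarrow> \<exists>d\<in>D. \<exists>y\<in>Y. norm (x - d - y) < e"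
  obtains g where "\<And>n x y. g n (x + y) = g n x + g n y" "\<And>n c x. g n (s c x) = c * g n x"
    "\<And>n x. norm (g n x) \<le> 2 * M * norm x"
    "\<And>n y. y \<in> Y \<Longrightarrow> g n y = f n y" "\<And>x. ((\<lambda>n. g n x) \<longlongrightarrow> 0) F"
proof -
  interpret banach_space s by (rule s)
  have scaleR_eq: "r *\<^sub>R x = s (of_real r) x" for r x by (simp add: scale_of_real)
  have Y': "Real_Vector_Spaces.subspace Y" by (rule real_subspace[OF Y])
  have real_parts: "\<exists>S. (\<forall>n. linear (S n)) \<and> (\<forall>n x. \<bar>S n x\<bar> \<le> 2 * M * norm x) \<and>
      (\<forall>n. \<forall>y\<in>Y. S n y = re (f n y)) \<and> (\<forall>x. ((\<lambda>n. S n x) \<longlongrightarrow> 0) F)"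
    if re: "linear re" "\<And>c. \<bar>re c\<bar> \<le> norm c" for re :: "'k \<Rightarrow> real"
  proof (rule extend_null_sequence_real[OF F Y' M, of "\<lambda>n x. re (f n x)" D])
    show "re (f n (x + y)) = re (f n x) + re (f n y)" if "x \<in> Y" "y \<in> Y" for n x y
      using that by (simp add: fadd linear_add[OF re(1)])
    show "re (f n (c *\<^sub>R x)) = c * re (f n x)" if "x \<in> Y" for n c x
      using that linear_scale[OF re(1), of c "f n x"]
      by (simp add: scaleR_eq fscale scaleR_conv_of_real)
    show "\<bar>re (f n y)\<bar> \<le> M * norm y" if "y \<in> Y" for n y
      using re(2) fle[OF that] by (rule order_trans)
    show "((\<lambda>n. re (f n y)) \<longlongrightarrow> 0) F" if "y \<in> Y" for y
      by (rule Lim_null_comparison[OF _ tendsto_norm_zero[OF null[OF that]]]) (simp add: re(2))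
  qed (use D dense in blast)+
  \<comment> \<open>A complex functional is determined by its real part \<open>S\<close> as \<open>S x - i * S (i * x)\<close>, so it
    suffices to extend the real parts.\<close>
  show thesis
  proof (cases rule: real_or_complex_cases[where 'k = 'k])
    case (real re)
    from real_parts[OF real(1,2)] obtain S where S: "\<And>n. linear (S n)" "\<And>n x. \<bar>S n x\<bar> \<le> 2 * M * norm x"
      "\<And>n y. y \<in> Y \<Longrightarrow> S n y = re (f n y)" "\<And>x. ((\<lambda>n. S n x) \<longlongrightarrow> 0) F" by metis
    show thesis
    proof (rule that[of "\<lambda>n x. of_real (S n x)"])
      show "of_real (S n (s c x)) = c * of_real (S n x)" for n c x
        using linear_scale[OF S(1), of n "re c" x] real(3)[of c] by (metis of_real_mult real_scaleR_def scaleR_eq)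
      show "of_real (S n y) = f n y" if "y \<in> Y" for n y
        using S(3)[OF that] real(3)[of "f n y"] by simp
      show "((\<lambda>n. of_real (S n x) :: 'k) \<longlongrightarrow> 0) F" for x
        using tendsto_of_real[OF S(4)[of x]] by simp
    qed (use S(2) in \<open>auto simp: linear_add[OF S(1)]\<close>)
  next
    case (complex j re)
    from real_parts[OF complex(1,2)] obtain S where S: "\<And>n. linear (S n)" "\<And>n x. \<bar>S n x\<bar> \<le> 2 * M * norm x"
      "\<And>n y. y \<in> Y \<Longrightarrow> S n y = re (f n y)" "\<And>x. ((\<lambda>n. S n x) \<longlongrightarrow> 0) F" by metis
    note S_simps = linear_add[OF S(1)] linear_scale[OF S(1)] linear_neg[OF S(1)]
    define g where "g n x = of_real (S n x) - j * of_real (S n (s j x))" for n x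
    have g_add: "g n (x + y) = g n x + g n y" for n x y
      by (simp add: g_def S_simps scale_right_distrib algebra_simps)
    have g_of_real: "g n (s (of_real r) x) = of_real r * g n x" for n r x
    proof -
      have "s j (s (of_real r) x) = r *\<^sub>R s j x" by (simp add: scaleR_eq mult.commute)
      then show ?thesis by (simp add: g_def S_simps scale_of_real algebra_simps)
    qed
    have g_j: "g n (s j x) = j * g n x" for n x
    proof -
      have "s j (s j x) = - x" by (simp add: complex(3))
      moreover have "j * (j * z) = - z" for z by (metis complex(3) mult.assoc mult_minus1)
      ultimately show ?thesis unfolding g_def right_diff_distrib by (simp add: S_simps del: scale_scale)
    qed
    \<comment> \<open>Every scalar is a real combination of 1 and \<open>j\<close>, so homogeneity
      for real scalars and for \<open>j\<close> suffices.\<close>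
    have decomp: "s c x = s (of_real (re c)) x + s (of_real (- re (j * c))) (s j x)" for c x
      by (subst complex(4)) (simp add: scale_left_diff_distrib mult.commute)
    have g_scale: "g n (s c x) = c * g n x" for n c x
    proof -
      have "g n (s c x) = (of_real (re c) - j * of_real (re (j * c))) * g n x"
        unfolding decomp[of c x] g_add g_of_real g_j by (simp add: algebra_simps)
      then show ?thesis using complex(4)[of c] by simp
    qed
    show thesis
    proof (rule that[of g])
      show "norm (g n x) \<le> 2 * M * norm x" for n x
      proof -
        \<comment> \<open>The scalar \<open>c\<close> is the conjugate of \<open>g n x\<close>. Thus
          \<open>S n (s c x)\<close> equals the square of \<open>norm (g n x)\<close>, and the bound
          for \<open>S n\<close> at \<open>s c x\<close> gives the same bound for \<open>g n\<close>
          after cancelling one factor.\<close>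
        define a b c where "a = S n x" and "b = S n (s j x)" and "c = of_real a + j * of_real b"
        have norm_g: "(norm (g n x))\<^sup>2 = a\<^sup>2 + b\<^sup>2"
          using complex(5)[of a "- b"] by (simp add: g_def a_def b_def)
        then have norm_c: "norm c = norm (g n x)"
          using complex(5)[of a b] by (simp add: c_def power2_eq_iff_nonneg flip: norm_g)
        have "s c x = a *\<^sub>R x + b *\<^sub>R s j x"
          by (simp add: c_def scale_left_distrib scaleR_eq mult.commute)
        then have "S n (s c x) = a\<^sup>2 + b\<^sup>2"
          by (simp add: S_simps a_def b_def power2_eq_square)
        then have "(norm (g n x))\<^sup>2 \<le> 2 * M * norm (s c x)"
          using S(2)[of n "s c x"] norm_g by simp
        also have "\<dots> = norm (g n x) * (2 * M * norm x)" by (simp add: norm_scale norm_c)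
        finally show ?thesis
          using M by (cases "g n x = 0") (simp_all add: power2_eq_square)
      qed
      show "g n y = f n y" if "y \<in> Y" for n y
        using complex(4)[of "f n y"] S(3)[OF that] S(3)[OF subspace_scale[OF Y that, of j]]
        by (simp add: g_def fscale[OF that])
      show "((\<lambda>n. g n x) \<longlongrightarrow> 0) F" for x
        using tendsto_diff[OF tendsto_of_real[OF S(4)[of x]]
            tendsto_mult[OF tendsto_const tendsto_of_real[OF S(4)[of "s j x"]]], of j]
        by (simp add: g_def)
    qed (use g_add g_scale in auto)
  qed
qed

subsection \<open>Extension of operators\<close>

text \<open>The coordinates of \<open>T\<close> form a null sequence of functionals along the
  filter, with common bound \<open>M\<close>. In the sup norm, the bound on the extended coordinates
  is a bound on the operator they define.\<close>

theorem extend_to_c0_ideal: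
  fixes s :: "'k::real_or_complex \<Rightarrow> 'a::banach \<Rightarrow> 'a" and T :: "'a \<Rightarrow> nat \<Rightarrow>\<^sub>C 'k"
  assumes I: "ideal_on_omega I" and s: "banach_space s" and Y: "module.subspace s Y"
    and T: "bounded_operator_on s scale_linf Y (c0_ideal I) T"
    and D: "countable D" and dense: "\<And>x e. 0 < e \<Longrightarrow> \<exists>d\<in>D. \<exists>y\<in>Y. norm (x - d - y) < e"
  shows "\<exists>T'. bounded_operator_on s scale_linf UNIV (c0_ideal I) T' \<and> (\<forall>y\<in>Y. T' y = T y) \<and>
           onorm_on UNIV T' \<le> 2 * onorm_on Y T"
proof -
  interpret banach_space s by (rule s)
  define M where "M = onorm_on Y T"
  from T obtain K where K: "\<And>x. x \<in> Y \<Longrightarrow> norm (T x) \<le> K * norm x"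
    unfolding bounded_operator_on_def by blast
  have bdd: "bdd_above ((\<lambda>x. norm (T x) / norm x) ` Y)"
  proof (rule bdd_aboveI2)
    \<comment> \<open>The maximum with 0 covers the quotient at \<open>x = 0\<close>, which is 0
      even if \<open>K\<close> is negative.\<close>
    show "norm (T x) / norm x \<le> max K 0" if "x \<in> Y" for x
      using order_trans[OF K[OF that] mult_right_mono[of K "max K 0"]]
      by (cases "x = 0") (auto simp: divide_le_eq)
  qed
  have ratio: "norm (T x) / norm x \<le> M" if "x \<in> Y" for x
    unfolding M_def onorm_on_def by (rule cSUP_upper[OF that bdd])
  have M: "0 \<le> M" using ratio[OF subspace_0[OF Y]] by simp
  have T_le: "norm (T x) \<le> M * norm x" if "x \<in> Y" for x
    using ratio[OF that] K[OF that] by (cases "x = 0") (auto simp: divide_le_eq)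
  define f where "f n x = apply_bcontfun (T x) n" for n x
  obtain g where g: "\<And>n x y. g n (x + y) = g n x + g n y" "\<And>n c x. g n (s c x) = c * g n x"
    "\<And>n x. norm (g n x) \<le> 2 * M * norm x" "\<And>n y. y \<in> Y \<Longrightarrow> g n y = f n y"
    "\<And>x. ((\<lambda>n. g n x) \<longlongrightarrow> 0) (ideal_filter I)"
  proof (rule extend_null_sequence[OF s ideal_filter_le_sequentially[OF I] Y M, of f D])
    show "f n (x + y) = f n x + f n y" if "x \<in> Y" "y \<in> Y" for n x y
      using T that by (simp add: f_def bounded_operator_on_def plus_bcontfun.rep_eq)
    show "f n (s c x) = c * f n x" if "x \<in> Y" for n c x
      using T that by (simp add: f_def bounded_operator_on_def apply_scale_linf)
    show "norm (f n y) \<le> M * norm y" if "y \<in> Y" for n y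
      unfolding f_def using norm_bounded T_le[OF that] by (rule order_trans)
    show "((\<lambda>n. f n y) \<longlongrightarrow> 0) (ideal_filter I)" if "y \<in> Y" for y
    proof -
      have "T y \<in> c0_ideal I" using T that by (auto simp: bounded_operator_on_def)
      then show ?thesis by (simp add: c0_ideal_iff_tendsto[OF I] f_def)
    qed
  qed (use D dense in blast)+
  define T' where "T' x = Bcontfun (\<lambda>n. g n x)" for x
  have T'_apply: "apply_bcontfun (T' x) = (\<lambda>n. g n x)" for x
  proof -
    have "(\<lambda>n. g n x) \<in> bcontfun" by (rule bcontfun_normI[where b = "2 * M * norm x"]) (auto simp: g(3))
    then show ?thesis by (simp add: T'_def Bcontfun_inverse)
  qed
  have T'_le: "norm (T' x) \<le> 2 * M * norm x" for x
    by (rule norm_bound) (simp add: T'_apply g(3))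
  have "bounded_operator_on s scale_linf UNIV (c0_ideal I) T'"
    unfolding bounded_operator_on_def using T'_le
    by (auto intro!: bcontfun_eqI exI[of _ "2 * M"]
        simp: T'_apply g plus_bcontfun.rep_eq apply_scale_linf c0_ideal_iff_tendsto[OF I])
  moreover have "T' y = T y" if "y \<in> Y" for y
    by (rule bcontfun_eqI) (simp add: T'_apply g(4)[OF that] f_def)
  moreover have "onorm_on UNIV T' \<le> 2 * M"
    unfolding onorm_on_def
  proof (rule cSUP_least)
    show "norm (T' x) / norm x \<le> 2 * M" for x
      using T'_le[of x] M by (cases "x = 0") (auto simp: divide_le_eq)
  qed simp
  ultimately show ?thesis unfolding M_def by blast
qed

section \<open>Countable sets that are dense modulo a subspace\<close>

text \<open>One representative is chosen from each coset in a countable dense set. A coset distance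
  below \<open>e\<close> is an infimum over \<open>Y\<close>, so some \<open>y\<close> in
  \<open>Y\<close> realizes a distance below \<open>e\<close>.\<close>

lemma separable_quotient_imp_dense:
  fixes Y :: "'a::real_normed_vector set"
  assumes Y: "subspace Y" "closed Y" and sep: "separable_space (quotient_topology Y)"
  obtains D where "countable D" "\<And>x e. 0 < e \<Longrightarrow> \<exists>d\<in>D. \<exists>y\<in>Y. norm (x - d - y) < e"
proof -
  interpret Q: Metric_space "cosets Y" quotient_dist by (rule Metric_space_quotient[OF Y])
  obtain \<C> where \<C>: "countable \<C>" "\<C> \<subseteq> cosets Y" "Q.mtopology closure_of \<C> = cosets Y"
    using sep by (auto simp: separable_space_def quotient_topology_def)
  define rep where "rep C = (SOME x. C = (+) x ` Y)" for C :: "'a set"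
  have rep: "C = (+) (rep C) ` Y" if "C \<in> cosets Y" for C
    unfolding rep_def by (rule someI_ex) (use that in \<open>auto simp: cosets_alt[OF Y(1)]\<close>)
  have "\<exists>d\<in>rep ` \<C>. \<exists>y\<in>Y. norm (x - d - y) < e" if e: "0 < e" for x e
  proof -
    have "(+) x ` Y \<in> Q.mtopology closure_of \<C>" using \<C>(3) by (auto simp: cosets_alt[OF Y(1)])
    with e obtain C where C: "C \<in> \<C>" "quotient_dist ((+) x ` Y) C < e"
      unfolding Q.metric_closure_of by (auto simp: Q.in_mball)
    then have "infdist (x - rep C) Y < e"
      using rep[of C] \<C>(2) quotient_dist_cosets[OF Y(1), of x "rep C"] by auto
    moreover have "Y \<noteq> {}" using subspace_0[OF Y(1)] by blast
    ultimately obtain y where "y \<in> Y" "dist (x - rep C) y < e"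
      using cInf_lessD[of "dist (x - rep C) ` Y" e] by (auto simp: infdist_notempty)
    with C(1) show ?thesis by (auto simp: dist_norm)
  qed
  with \<C>(1) show thesis by (intro that[of "rep ` \<C>"]) auto
qed

text \<open>The choice \<open>y = 0\<close> always works. This serves separable injectivity, where
  the subspace may fail to be closed and coset distance may fail to be a metric.\<close>

lemma separable_euclidean_imp_dense:
  fixes Y :: "'a::real_normed_vector set"
  assumes "separable_space (euclidean :: 'a topology)" and "0 \<in> Y"
  obtains D where "countable D" "\<And>x e. 0 < e \<Longrightarrow> \<exists>d\<in>D. \<exists>y\<in>Y. norm (x - d - y) < e"
proof -
  obtain D :: "'a set" where D: "countable D" "closure D = UNIV"
    using assms(1) by (auto simp: separable_space_def)
  have "\<exists>d\<in>D. \<exists>y\<in>Y. norm (x - d - y) < e" if "0 < e" for x e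
  proof -
    have "x \<in> closure D" using D(2) by simp
    with that obtain d where "d \<in> D" "dist d x < e" unfolding closure_approachable by blast
    with assms(2) show ?thesis by (intro bexI[of _ d] bexI[of _ 0]) (auto simp: dist_norm norm_minus_commute)
  qed
  with D(1) show thesis by (rule that)
qed

text \<open>Both claims are instances of \<open>extend_to_c0_ideal\<close>. They differ in the
  source of the countable set: separability of the quotient in the first, of the whole space in the
  second.\<close>

theorem theorem5p5:
  fixes I :: "nat set set"
  assumes "ideal_on_omega I"
  shows "(\<forall>(s :: 'k::real_or_complex \<Rightarrow> 'x::banach \<Rightarrow> 'x) Y (T :: 'x \<Rightarrow> nat \<Rightarrow>\<^sub>C 'k).
            banach_space s \<and> module.subspace s Y \<and> closed Y \<and>
            separable_space (quotient_topology Y) \<and>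
            bounded_operator_on s scale_linf Y (c0_ideal I) T \<longrightarrow>
            (\<exists>T'. bounded_operator_on s scale_linf UNIV (c0_ideal I) T' \<and>
                  (\<forall>y\<in>Y. T' y = T y) \<and>
                  onorm_on UNIV T' \<le> 2 * onorm_on Y T)) \<and>
         separably_injective TYPE('z::banach) 2
           (scale_linf :: 'k \<Rightarrow> (nat \<Rightarrow>\<^sub>C 'k) \<Rightarrow> (nat \<Rightarrow>\<^sub>C 'k)) (c0_ideal I)"
proof (intro conjI allI impI)
  fix s :: "'k \<Rightarrow> 'x \<Rightarrow> 'x" and Y and T :: "'x \<Rightarrow> nat \<Rightarrow>\<^sub>C 'k"
  assume *: "banach_space s \<and> module.subspace s Y \<and> closed Y \<and>
    separable_space (quotient_topology Y) \<and> bounded_operator_on s scale_linf Y (c0_ideal I) T"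
  then interpret banach_space s by blast
  have "Real_Vector_Spaces.subspace Y" using * real_subspace by blast
  moreover have "closed Y" "separable_space (quotient_topology Y)" using * by blast+
  ultimately obtain D where "countable D" "\<And>x e. 0 < e \<Longrightarrow> \<exists>d\<in>D. \<exists>y\<in>Y. norm (x - d - y) < e"
    by (rule separable_quotient_imp_dense) blast
  with * show "\<exists>T'. bounded_operator_on s scale_linf UNIV (c0_ideal I) T' \<and> (\<forall>y\<in>Y. T' y = T y) \<and>
      onorm_on UNIV T' \<le> 2 * onorm_on Y T"
    by (intro extend_to_c0_ideal[OF assms]) auto
next
  show "separably_injective TYPE('z) 2 (scale_linf :: 'k \<Rightarrow> _) (c0_ideal I)"
    unfolding separably_injective_def
  proof (intro conjI allI impI)
    fix s :: "'k \<Rightarrow> 'z \<Rightarrow> 'z" and Y and T :: "'z \<Rightarrow> nat \<Rightarrow>\<^sub>C 'k"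
    assume sep: "separable_space (euclidean :: 'z topology)" and s: "banach_space s"
      and *: "module.subspace s Y \<and> bounded_operator_on s scale_linf Y (c0_ideal I) T"
    interpret banach_space s by (rule s)
    have "0 \<in> Y" using * subspace_0 by blast
    then obtain D where "countable D" "\<And>x e. 0 < e \<Longrightarrow> \<exists>d\<in>D. \<exists>y\<in>Y. norm (x - d - y) < e"
      by (rule separable_euclidean_imp_dense[OF sep]) blast
    with * show "\<exists>T'. bounded_operator_on s scale_linf UNIV (c0_ideal I) T' \<and> (\<forall>y\<in>Y. T' y = T y) \<and>
        onorm_on UNIV T' \<le> 2 * onorm_on Y T"
      by (intro extend_to_c0_ideal[OF assms s]) auto
  qed (rule banach_space_scale_linf subspace_c0_ideal[OF assms] closed_c0_ideal[OF assms])+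
qed

end
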